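(* Let $n\ge 0$ be an integer. If $n$ is congruent to one of $2,3,15,94$ modulo $120$, then $E_n(1,x)$ is a permutation polynomial over $\mathbb{Z}_5$.
   Context: The $n$th reversed Dickson polynomial of the second kind (with parameter $1$) is the integer-coefficient polynomial $E_n(1,x)=\sum_{i=0}^{\lfloor n/2\rfloor}\binom{n-i}{i}(-x)^i$; equivalently $E_0(1,x)=1$, $E_1(1,x)=1$, $E_n(1,x)=E_{n-1}(1,x)-x\,E_{n-2}(1,x)$ for $n\ge 2$. A polynomial is a permutation polynomial over $\mathbb{Z}_5$ (the integers modulo $5$) if the map it induces $\mathbb{Z}_5\to\mathbb{Z}_5$ is a bijection. *)

theory Defs
  imports
    "HOL-Computational_Algebra.Polynomial"
    "HOL-Number_Theory.Cong"
    "HOL-Library.Numeral_Type"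
begin

text \<open>The polynomials \<open>E\<^sub>n(1,x)\<close> with integer coefficients; \<open>[:0, -1:]\<close> is \<open>-x\<close>.\<close>

definition rev_dickson2 :: "nat \<Rightarrow> int poly" where
  "rev_dickson2 n = (\<Sum>i\<le>n div 2. of_nat ((n - i) choose i) * [:0, -1:] ^ i)"

lemma rev_dickson2_0: "rev_dickson2 0 = 1"
  by (simp add: rev_dickson2_def)

lemma rev_dickson2_1: "rev_dickson2 1 = 1"
  by (simp add: rev_dickson2_def)

lemma rev_dickson2_extend:
  "rev_dickson2 n = (\<Sum>i\<le>n. of_nat ((n - i) choose i) * [:0, -1:] ^ i)"
  unfolding rev_dickson2_def
  by (rule sum.mono_neutral_left) (auto simp: binomial_eq_0)

lemma rev_dickson2_rec:
  "rev_dickson2 (n + 2) = rev_dickson2 (n + 1) - [:0, 1:] * rev_dickson2 n"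
proof -
  define X :: "int poly" where "X = [:0, -1:]"
  have X: "[:0, 1:] = - X" by (simp add: X_def)
  have c: "Suc n - i choose Suc i = (n - i choose Suc i) + (n - i choose i)" if "i \<le> n" for i
    using that by (simp add: Suc_diff_le)
  have "rev_dickson2 (n + 2) =
      1 + (\<Sum>i\<le>Suc n. of_nat (Suc n - i choose Suc i) * X ^ Suc i)"
    unfolding rev_dickson2_extend X_def[symmetric] add_2_eq_Suc'
    by (subst sum.atMost_Suc_shift) simp
  also have "\<dots> = 1 + (\<Sum>i\<le>n. of_nat (Suc n - i choose Suc i) * X ^ Suc i)"
    by simp
  also have "\<dots> = 1 + (\<Sum>i\<le>n. of_nat (n - i choose Suc i) * X ^ Suc i)
      + X * (\<Sum>i\<le>n. of_nat (n - i choose i) * X ^ i)"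
    by (simp add: c sum.distrib sum_distrib_left algebra_simps)
  also have "1 + (\<Sum>i\<le>n. of_nat (n - i choose Suc i) * X ^ Suc i) = rev_dickson2 (n + 1)"
    unfolding rev_dickson2_extend X_def[symmetric]
    unfolding Suc_eq_plus1[symmetric] by (subst sum.atMost_Suc_shift) simp
  finally show ?thesis
    by (simp add: X rev_dickson2_extend X_def[symmetric])
qed

definition permutation_poly :: "'a::comm_ring_1 poly \<Rightarrow> bool" where
  "permutation_poly p \<longleftrightarrow> bij (poly p)"

text \<open>
  The numeral type \<open>5\<close> of \<^theory>\<open>HOL-Library.Numeral_Type\<close>, with its ring structure, is the
  ring of integers modulo 5; \<open>map_poly of_int\<close> reduces coefficients modulo 5.
\<close>

end

theory Submission
  imports Defs
begin

text \<open>
  Fix \<open>x \<in> \<int>\<^sub>5\<close> and let \<open>y\<close>, \<open>1 - y\<close> be the roots of \<open>T\<^sup>2 - T + x\<close>. The values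
  \<open>u n = E\<^sub>n(1,x)\<close> satisfy the linear recurrence with this characteristic polynomial, and the
  discriminant \<open>1 - 4 * x\<close> decides how \<open>u\<close> repeats.

  \<^item> For \<open>x = 1, 2\<close> the discriminant is a nonresidue. The Frobenius map of the field with 25
    elements exchanges the roots, so \<open>y ^ 6 = y * (1 - y) = x\<close> and \<open>u (n + 6) = x * u n\<close>.
  \<^item> For \<open>x = 3\<close> it is a nonzero square. Both roots lie in the multiplicative group of
    \<open>\<int>\<^sub>5\<close>, so \<open>y ^ 4 = 1\<close> and \<open>u (n + 4) = u n\<close>.
  \<^item> For \<open>x = 4\<close> it is zero. The double root is \<open>3\<close>, and \<open>(T - 3) ^ 5 = T ^ 5 - 3\<close>
    is a multiple of the characteristic polynomial, so \<open>u (n + 5) = 3 * u n\<close>.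
  \<^item> For \<open>x = 0\<close> the recurrence says that \<open>u\<close> is constant.

  The first three cases are \<open>rev_dickson2_mod5_shift\<close>, the last is
  \<open>rev_dickson2_mod5_at_0\<close>. All these sequences have a period dividing
  \<open>120\<close>, so only the four given residues have to be considered. The same relations reduce each of these indices to an index below \<open>6\<close>. In the
  order \<open>x = 0, 1, 2, 3, 4\<close> the values are \<open>1, 0, 4, 3, 2\<close> for \<open>n = 2\<close>;
  \<open>1, 4, 2, 0, 3\<close> for \<open>n = 3\<close>; \<open>1, 4, 3, 0, 2\<close> for \<open>n = 15\<close>; and
  \<open>1, 4, 2, 3, 0\<close> for \<open>n = 94\<close>. Each list exhausts \<open>\<int>\<^sub>5\<close>.
\<close>

definition rev_dickson2_mod5 :: "nat \<Rightarrow> 5 \<Rightarrow> 5" where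
  "rev_dickson2_mod5 n = poly (map_poly of_int (rev_dickson2 n))"

lemma rev_dickson2_mod5_0: "rev_dickson2_mod5 0 x = 1"
  by (simp add: rev_dickson2_mod5_def rev_dickson2_0)

lemma rev_dickson2_mod5_1: "rev_dickson2_mod5 (Suc 0) x = 1"
  using rev_dickson2_1 by (simp add: rev_dickson2_mod5_def)

lemma rev_dickson2_mod5_rec:
  "rev_dickson2_mod5 (Suc (Suc n)) x = rev_dickson2_mod5 (Suc n) x - x * rev_dickson2_mod5 n x"
proof -
  have diff: "map_poly of_int (p - q) = (map_poly of_int p - map_poly of_int q :: 5 poly)" for p q
    by (rule poly_eqI) (simp add: coeff_map_poly)
  have shift: "map_poly of_int ([:0, 1:] * p) = ([:0, 1:] * map_poly of_int p :: 5 poly)" for p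
    by (rule poly_eqI) (simp add: coeff_map_poly coeff_pCons split: nat.split)
  have "rev_dickson2 (Suc (Suc n)) = rev_dickson2 (Suc n) - [:0, 1:] * rev_dickson2 n"
    using rev_dickson2_rec[of n] by simp
  then show ?thesis
    unfolding rev_dickson2_mod5_def by (simp only: diff shift) simp
qed

lemmas rev_dickson2_mod5_simps =
  rev_dickson2_mod5_0 rev_dickson2_mod5_1 rev_dickson2_mod5_rec

lemma UNIV_mod5: "(UNIV :: 5 set) = {0, 1, 2, 3, 4}"
  by (rule sym, rule card_seteq) simp_all

lemma rev_dickson2_mod5_at_0: "rev_dickson2_mod5 n 0 = 1"
  by (induction n rule: induct_nat_012) (simp_all add: rev_dickson2_mod5_simps)

text \<open>
  Write \<open>u\<close> for the sequence at the given point.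
  The shifted value is a combination of \<open>u n\<close> and \<open>u (Suc n)\<close> with integer coefficients, by
  repeated use of the recurrence; it differs from the right-hand side by a multiple of \<open>5\<close>.
\<close>

lemma rev_dickson2_mod5_shift:
  "rev_dickson2_mod5 (n + 6) 1 = rev_dickson2_mod5 n 1"
  "rev_dickson2_mod5 (n + 6) 2 = 2 * rev_dickson2_mod5 n 2"
  "rev_dickson2_mod5 (n + 4) 3 = rev_dickson2_mod5 n 3"
  "rev_dickson2_mod5 (n + 5) 4 = 3 * rev_dickson2_mod5 n 4"
proof -
  have five: "5 * a = 0" for a :: 5
  proof -
    have "(5 :: 5) = 0" by simp
    then show ?thesis by (simp only: mult_zero_left)
  qed
  have idx: "n + 4 = Suc (Suc (Suc (Suc n)))" "n + 5 = Suc (Suc (Suc (Suc (Suc n))))"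
    "n + 6 = Suc (Suc (Suc (Suc (Suc (Suc n)))))"
    by simp_all
  show "rev_dickson2_mod5 (n + 6) 1 = rev_dickson2_mod5 n 1"
    unfolding idx rev_dickson2_mod5_rec by (simp add: algebra_simps)
  have "rev_dickson2_mod5 (n + 6) 2 =
      2 * rev_dickson2_mod5 n 2 + 5 * rev_dickson2_mod5 (Suc n) 2"
    unfolding idx rev_dickson2_mod5_rec by (simp add: algebra_simps)
  then show "rev_dickson2_mod5 (n + 6) 2 = 2 * rev_dickson2_mod5 n 2"
    by (simp only: five add_0_right)
  have "rev_dickson2_mod5 (n + 4) 3 =
      rev_dickson2_mod5 n 3 + 5 * (rev_dickson2_mod5 n 3 - rev_dickson2_mod5 (Suc n) 3)"
    unfolding idx rev_dickson2_mod5_rec by (simp add: algebra_simps)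
  then show "rev_dickson2_mod5 (n + 4) 3 = rev_dickson2_mod5 n 3"
    by (simp only: five add_0_right)
  have "rev_dickson2_mod5 (n + 5) 4 =
      3 * rev_dickson2_mod5 n 4 + 5 * (rev_dickson2_mod5 (Suc n) 4 + 5 * rev_dickson2_mod5 n 4)"
    unfolding idx rev_dickson2_mod5_rec by (simp add: algebra_simps)
  then show "rev_dickson2_mod5 (n + 5) 4 = 3 * rev_dickson2_mod5 n 4"
    by (simp only: five add_0_right)
qed

lemma iterate_shift:
  fixes f :: "nat \<Rightarrow> 'a::comm_monoid_mult"
  assumes "\<And>n. f (n + d) = c * f n"
  shows "f (n + d * k) = c ^ k * f n"
proof (induction k)
  case (Suc k)
  have "f (n + d * Suc k) = f (n + d * k + d)"
    by (simp add: algebra_simps)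
  with Suc assms show ?case
    by (simp add: mult.assoc)
qed simp

lemma rev_dickson2_mod5_shift_mult:
  "rev_dickson2_mod5 (n + 6 * k) 1 = rev_dickson2_mod5 n 1"
  "rev_dickson2_mod5 (n + 6 * k) 2 = 2 ^ k * rev_dickson2_mod5 n 2"
  "rev_dickson2_mod5 (n + 4 * k) 3 = rev_dickson2_mod5 n 3"
  "rev_dickson2_mod5 (n + 5 * k) 4 = 3 ^ k * rev_dickson2_mod5 n 4"
  using iterate_shift[of "\<lambda>n. rev_dickson2_mod5 n 1" 6 1]
    iterate_shift[of "\<lambda>n. rev_dickson2_mod5 n 2" 6 2]
    iterate_shift[of "\<lambda>n. rev_dickson2_mod5 n 3" 4 1]
    iterate_shift[of "\<lambda>n. rev_dickson2_mod5 n 4" 5 3]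
  by (simp_all add: rev_dickson2_mod5_shift)

lemma rev_dickson2_mod5_periodic:
  "rev_dickson2_mod5 (r + 120 * q) x = rev_dickson2_mod5 r x"
proof -
  have pow: "(2 :: 5) ^ (20 * q) = 1" "(3 :: 5) ^ (24 * q) = 1"
  proof -
    have "(2 :: 5) ^ 20 = 1" "(3 :: 5) ^ 24 = 1"
      by simp_all
    then show "(2 :: 5) ^ (20 * q) = 1" "(3 :: 5) ^ (24 * q) = 1"
      by (simp_all only: power_mult power_one)
  qed
  consider "x = 0" | "x = 1" | "x = 2" | "x = 3" | "x = 4"
    using UNIV_mod5 by blast
  then show ?thesis
    using rev_dickson2_mod5_shift_mult(1)[of r "20 * q"]
      rev_dickson2_mod5_shift_mult(2)[of r "20 * q"]
      rev_dickson2_mod5_shift_mult(3)[of r "30 * q"]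
      rev_dickson2_mod5_shift_mult(4)[of r "24 * q"]
    by cases (simp_all add: rev_dickson2_mod5_at_0 pow)
qed

lemma rev_dickson2_mod5_2: "rev_dickson2_mod5 2 x = 1 - x"
  by (simp add: numeral_2_eq_2 rev_dickson2_mod5_simps)

lemma rev_dickson2_mod5_3: "rev_dickson2_mod5 3 x = 1 - 2 * x"
  by (simp add: numeral_3_eq_3 rev_dickson2_mod5_simps)

lemma rev_dickson2_mod5_4: "rev_dickson2_mod5 4 x = 1 - 3 * x + x ^ 2"
proof -
  have "rev_dickson2_mod5 4 x = rev_dickson2_mod5 3 x - x * rev_dickson2_mod5 2 x"
    using rev_dickson2_mod5_rec[of 2 x] by simp
  then show ?thesis
    unfolding rev_dickson2_mod5_2 rev_dickson2_mod5_3 by (simp add: algebra_simps power2_eq_square)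
qed

lemma bij_mod5I:
  fixes f :: "5 \<Rightarrow> 5"
  assumes "{f 0, f 1, f 2, f 3, f 4} = {0, 1, 2, 3, 4}"
  shows "bij f"
proof -
  have "range f = UNIV"
    using assms by (simp add: UNIV_mod5)
  then show ?thesis
    by (simp add: bij_def finite_UNIV_surj_inj)
qed

lemma bij_rev_dickson2_mod5:
  assumes "r \<in> {2, 3, 15, 94}"
  shows "bij (rev_dickson2_mod5 r)"
proof -
  have v15: "rev_dickson2_mod5 15 1 = 4" "rev_dickson2_mod5 15 2 = 3"
    "rev_dickson2_mod5 15 3 = 0" "rev_dickson2_mod5 15 4 = 2"
    using rev_dickson2_mod5_shift_mult(1)[of 3 2] rev_dickson2_mod5_shift_mult(2)[of 3 2]
      rev_dickson2_mod5_shift_mult(3)[of 3 3] rev_dickson2_mod5_shift_mult(4)[of 0 3]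
    by (simp_all add: rev_dickson2_mod5_3 rev_dickson2_mod5_0)
  have v94: "rev_dickson2_mod5 94 1 = 4" "rev_dickson2_mod5 94 2 = 2"
    "rev_dickson2_mod5 94 3 = 3" "rev_dickson2_mod5 94 4 = 0"
    using rev_dickson2_mod5_shift_mult(1)[of 4 15] rev_dickson2_mod5_shift_mult(2)[of 4 15]
      rev_dickson2_mod5_shift_mult(3)[of 2 23] rev_dickson2_mod5_shift_mult(4)[of 4 18]
    by (simp_all add: rev_dickson2_mod5_2 rev_dickson2_mod5_4)
  from assms consider "r = 2" | "r = 3" | "r = 15" | "r = 94"
    by blast
  then show ?thesis
  proof cases
    case 1
    show ?thesis
      unfolding 1 by (rule bij_mod5I) (auto simp: rev_dickson2_mod5_2)
  next
    case 2
    show ?thesis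
      unfolding 2 by (rule bij_mod5I) (auto simp: rev_dickson2_mod5_3)
  next
    case 3
    show ?thesis
      unfolding 3 by (rule bij_mod5I) (auto simp: rev_dickson2_mod5_at_0 v15)
  next
    case 4
    show ?thesis
      unfolding 4 by (rule bij_mod5I) (auto simp: rev_dickson2_mod5_at_0 v94)
  qed
qed

theorem theorem4p27:
  fixes n :: nat
  assumes "\<exists>r\<in>{2, 3, 15, 94}. [n = r] (mod 120)"
  shows "permutation_poly (map_poly of_int (rev_dickson2 n) :: 5 poly)"
proof -
  obtain r where r: "r \<in> {2, 3, 15, 94}" "[n = r] (mod 120)"
    using assms by blast
  then have "n mod 120 = r"
    by (auto simp: cong_def)
  then have n: "n = r + 120 * (n div 120)"
    by presburger
  have "rev_dickson2_mod5 n = rev_dickson2_mod5 r"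
    by (subst n) (rule ext, rule rev_dickson2_mod5_periodic)
  with bij_rev_dickson2_mod5[OF r(1)] show ?thesis
    unfolding permutation_poly_def rev_dickson2_mod5_def by simp
qed

end
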